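(* Let $\mathfrak{A}$ be a $C^*$-algebra, let $H$ be a Hilbert $\mathfrak{A}$-module, and let $A,B\in\mathcal{L}(H)$ be such that $A+B$ is M-P invertible. Then $A$ and $B$ are parallel summable if and only if $$A=A(A+B)^\dagger(A+B)\quad\text{and}\quad B=(A+B)(A+B)^\dagger B.$$
   Context: For a (right) Hilbert $\mathfrak{A}$-module $H$, $\mathcal{L}(H)$ denotes the $C^*$-algebra of adjointable operators $H\to H$. An operator $T\in\mathcal{L}(H)$ is M-P invertible if there is $X\in\mathcal{L}(H)$ with $TXT=T$, $XTX=X$, $(TX)^*=TX$, $(XT)^*=XT$; such $X$ is unique, is called the Moore-Penrose inverse of $T$, and is denoted $T^\dagger$. If $T$ is M-P invertible, a $\{1\}$-inverse of $T$ is any $T^-\in\mathcal{L}(H)$ with $TT^-T=T$. For $A,B\in\mathcal{L}(H)$ with $A+B$ M-P invertible, $A$ and $B$ are said to be parallel summable if $A(A+B)^-B$ is the same operator for every choice of $\{1\}$-inverse $(A+B)^-$ of $A+B$. *)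

theory Defs
  imports Complex_Main
begin

class scaleC = scaleR +
  fixes scaleC :: "complex \<Rightarrow> 'a \<Rightarrow> 'a"  (infixr \<open>*\<^sub>C\<close> 75)
  assumes scaleR_scaleC: "scaleR r = scaleC (complex_of_real r)"

class complex_vector = scaleC + ab_group_add +
  assumes scaleC_add_right: "c *\<^sub>C (x + y) = c *\<^sub>C x + c *\<^sub>C y"
    and scaleC_add_left: "(c + d) *\<^sub>C x = c *\<^sub>C x + d *\<^sub>C x"
    and scaleC_scaleC: "c *\<^sub>C (d *\<^sub>C x) = (c * d) *\<^sub>C x"
    and scaleC_one: "1 *\<^sub>C x = x"

text \<open>The algebra need not be unital: \<open>real_normed_algebra\<close> has no unit.
  Homogeneity of the norm under complex scalars is a consequence of the axioms.\<close>

class cstar_algebra = complex_vector + real_normed_algebra + banach +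
  fixes star :: "'a \<Rightarrow> 'a"
  assumes mult_scaleC_left: "(c *\<^sub>C a) * b = c *\<^sub>C (a * b)"
    and mult_scaleC_right: "a * (c *\<^sub>C b) = c *\<^sub>C (a * b)"
    and star_add: "star (a + b) = star a + star b"
    and star_scaleC: "star (c *\<^sub>C a) = cnj c *\<^sub>C star a"
    and star_mult: "star (a * b) = star b * star a"
    and star_star: "star (star a) = a"
    and cstar_identity: "norm (star a * a) = (norm a)\<^sup>2"

definition cstar_positive :: "'a::cstar_algebra \<Rightarrow> bool" where
  "cstar_positive a \<longleftrightarrow> (\<exists>b. a = star b * b)"

text \<open>The module is the whole type \<open>'h\<close> with right action \<open>act\<close>. The inner product \<open>ip\<close> is
  linear in the second argument. The last axiom says that the norm of the type is the one
  induced by \<open>ip\<close>, so that the class \<open>banach\<close> expresses completeness of the module.\<close>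

locale hilbert_cstar_module =
  fixes act :: "'h::{complex_vector, banach} \<Rightarrow> 'a::cstar_algebra \<Rightarrow> 'h"
    and ip :: "'h \<Rightarrow> 'h \<Rightarrow> 'a"
  assumes act_add_left: "act (x + y) a = act x a + act y a"
    and act_add_right: "act x (a + b) = act x a + act x b"
    and act_mult: "act x (a * b) = act (act x a) b"
    and act_scaleC_left: "act (c *\<^sub>C x) a = c *\<^sub>C act x a"
    and act_scaleC_right: "act x (c *\<^sub>C a) = c *\<^sub>C act x a"
    and ip_add_right: "ip x (y + z) = ip x y + ip x z"
    and ip_scaleC_right: "ip x (c *\<^sub>C y) = c *\<^sub>C ip x y"
    and ip_act_right: "ip x (act y a) = ip x y * a"
    and ip_star: "star (ip x y) = ip y x"
    and ip_positive: "cstar_positive (ip x x)"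
    and ip_definite: "ip x x = 0 \<Longrightarrow> x = 0"
    and norm_eq_sqrt_ip: "norm x = sqrt (norm (ip x x))"

definition is_adjoint :: "('h \<Rightarrow> 'h \<Rightarrow> 'a) \<Rightarrow> ('h \<Rightarrow> 'h) \<Rightarrow> ('h \<Rightarrow> 'h) \<Rightarrow> bool" where
  "is_adjoint ip T S \<longleftrightarrow> (\<forall>x y. ip (T x) y = ip x (S y))"

text \<open>Linearity over the scalars and over the algebra, and boundedness, follow from the
  existence of an adjoint.\<close>

definition adjointable :: "('h \<Rightarrow> 'h \<Rightarrow> 'a) \<Rightarrow> ('h \<Rightarrow> 'h) \<Rightarrow> bool" where
  "adjointable ip T \<longleftrightarrow> (\<exists>S. is_adjoint ip T S)"

definition adjoint_op :: "('h \<Rightarrow> 'h \<Rightarrow> 'a) \<Rightarrow> ('h \<Rightarrow> 'h) \<Rightarrow> ('h \<Rightarrow> 'h)" where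
  "adjoint_op ip T = (THE S. is_adjoint ip T S)"

definition op_add :: "('h \<Rightarrow> 'h) \<Rightarrow> ('h \<Rightarrow> 'h) \<Rightarrow> ('h::plus \<Rightarrow> 'h)"  (infixl \<open>+\<^sub>o\<close> 52) where
  "A +\<^sub>o B = (\<lambda>x. A x + B x)"

definition is_mp_inverse :: "('h \<Rightarrow> 'h \<Rightarrow> 'a) \<Rightarrow> ('h \<Rightarrow> 'h) \<Rightarrow> ('h \<Rightarrow> 'h) \<Rightarrow> bool" where
  "is_mp_inverse ip T X \<longleftrightarrow> adjointable ip X \<and>
     T \<circ> X \<circ> T = T \<and> X \<circ> T \<circ> X = X \<and>
     adjoint_op ip (T \<circ> X) = T \<circ> X \<and> adjoint_op ip (X \<circ> T) = X \<circ> T"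

definition mp_invertible :: "('h \<Rightarrow> 'h \<Rightarrow> 'a) \<Rightarrow> ('h \<Rightarrow> 'h) \<Rightarrow> bool" where
  "mp_invertible ip T \<longleftrightarrow> adjointable ip T \<and> (\<exists>X. is_mp_inverse ip T X)"

definition mp_inverse :: "('h \<Rightarrow> 'h \<Rightarrow> 'a) \<Rightarrow> ('h \<Rightarrow> 'h) \<Rightarrow> ('h \<Rightarrow> 'h)" where
  "mp_inverse ip T = (THE X. is_mp_inverse ip T X)"

definition is_one_inverse :: "('h \<Rightarrow> 'h \<Rightarrow> 'a) \<Rightarrow> ('h \<Rightarrow> 'h) \<Rightarrow> ('h \<Rightarrow> 'h) \<Rightarrow> bool" where
  "is_one_inverse ip T G \<longleftrightarrow> adjointable ip G \<and> T \<circ> G \<circ> T = T"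

definition parallel_summable ::
    "('h::plus \<Rightarrow> 'h \<Rightarrow> 'a) \<Rightarrow> ('h \<Rightarrow> 'h) \<Rightarrow> ('h \<Rightarrow> 'h) \<Rightarrow> bool" where
  "parallel_summable ip A B \<longleftrightarrow>
     adjointable ip A \<and> adjointable ip B \<and> mp_invertible ip (A +\<^sub>o B) \<and>
     (\<forall>G G'. is_one_inverse ip (A +\<^sub>o B) G \<longrightarrow> is_one_inverse ip (A +\<^sub>o B) G' \<longrightarrow>
        A \<circ> G \<circ> B = A \<circ> G' \<circ> B)"

context hilbert_cstar_module
begin

lemma ip_diff_right: "ip x (y - z) = ip x y - ip x z"
  using ip_add_right[of x "y - z" z] by (simp add: algebra_simps)

lemma ip_right_eqI:
  assumes "\<And>x. ip x y = ip x z"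
  shows "y = z"
  using ip_definite[of "y - z"] assms[of "y - z"] by (simp add: ip_diff_right)

lemma adjoint_op_eqI:
  assumes "is_adjoint ip T S"
  shows "adjoint_op ip T = S"
  unfolding adjoint_op_def
proof (rule the_equality)
  show "is_adjoint ip T S" by (fact assms)
next
  fix S' assume "is_adjoint ip T S'"
  then show "S' = S"
    using assms by (intro ext ip_right_eqI) (metis is_adjoint_def)
qed

lemma is_adjoint_adjoint_op:
  assumes "adjointable ip T"
  shows "is_adjoint ip T (adjoint_op ip T)"
  using assms adjoint_op_eqI unfolding adjointable_def by blast

lemma adjointable_comp:
  assumes "adjointable ip S" "adjointable ip T"
  shows "adjointable ip (S \<circ> T)"
  using assms unfolding adjointable_def is_adjoint_def by (metis comp_apply)

lemma mp_inverse_unique: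
  assumes T: "adjointable ip T" and X: "is_mp_inverse ip T X" and Y: "is_mp_inverse ip T Y"
  shows "X = Y"
proof -
  have sa: "ip (P x) y = ip x (P y)" if "adjointable ip P" "adjoint_op ip P = P" for P x y
    using is_adjoint_adjoint_op[OF that(1)] that(2) by (simp add: is_adjoint_def)
  note aX = X[unfolded is_mp_inverse_def, THEN conjunct1]
  note aY = Y[unfolded is_mp_inverse_def, THEN conjunct1]
  note saX = sa[OF adjointable_comp[OF T aX]] sa[OF adjointable_comp[OF aX T]]
  note saY = sa[OF adjointable_comp[OF T aY]] sa[OF adjointable_comp[OF aY T]]
  have TXT: "T (X (T x)) = T x" and XTX: "X (T (X x)) = X x"
    and TYT: "T (Y (T x)) = T x" and YTY: "Y (T (Y x)) = Y x" for x
    using X Y unfolding is_mp_inverse_def by (simp_all add: fun_eq_iff)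
  have sTX: "ip (T (X x)) y = ip x (T (X y))" and sXT: "ip (X (T x)) y = ip x (X (T y))" for x y
    using saX X unfolding is_mp_inverse_def by simp_all
  have sTY: "ip (T (Y x)) y = ip x (T (Y y))" and sYT: "ip (Y (T x)) y = ip x (Y (T y))" for x y
    using saY Y unfolding is_mp_inverse_def by simp_all
  have 1: "T (X z) = T (Y z)" for z
    by (rule ip_right_eqI) (metis sTX sTY TXT TYT)
  have 2: "X (T z) = Y (T z)" for z
    by (rule ip_right_eqI) (metis sXT sYT TXT TYT)
  show ?thesis
    by (rule ext) (metis 1 2 XTX YTY)
qed

lemma mp_inverse_eqI:
  assumes "adjointable ip T" "is_mp_inverse ip T X"
  shows "mp_inverse ip T = X"
  unfolding mp_inverse_def using assms mp_inverse_unique by (intro the_equality) auto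

end

end

theory Submission
  imports Defs
begin

text \<open>Put \<open>T = A + B\<close> and let \<open>X\<close> be a \<open>{1}\<close>-inverse of \<open>T\<close>. If \<open>A = A X T\<close> and \<open>B = T X B\<close>, then
  \<open>A G B = A X (T G T) X B = A X T X B\<close> does not depend on the \<open>{1}\<close>-inverse \<open>G\<close>. Conversely,
  with \<open>N = 1 - X T\<close> and \<open>M = 1 - T X\<close>, both \<open>X + N W\<close> and \<open>X + W M\<close> are \<open>{1}\<close>-inverses for every
  adjointable \<open>W\<close>, so \<open>A N W B = 0\<close> and \<open>A W M B = 0\<close>. From \<open>T N = 0\<close> and \<open>M T = 0\<close> one gets
  \<open>B N = - A N\<close> and \<open>M A = - M B\<close>; hence \<open>C W C = 0\<close> for \<open>C = A N\<close> and for \<open>C = M B\<close>, and the choice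
  \<open>W = C\<^sup>*\<close> forces \<open>C = 0\<close>.\<close>

context hilbert_cstar_module
begin

lemma ip_zero_right [simp]: "ip x 0 = 0"
  using ip_diff_right[of x 0 0] by simp

lemma ip_add_left: "ip (x + y) z = ip x z + ip y z"
  by (metis ip_star ip_add_right star_add)

lemma ip_diff_left: "ip (x - y) z = ip x z - ip y z"
  using ip_add_left[of "x - y" y z] by (simp add: algebra_simps)

lemma ip_zero_left [simp]: "ip 0 x = 0"
  using ip_diff_left[of 0 0 x] by simp

lemma is_adjoint_sym:
  assumes "is_adjoint ip T S"
  shows "is_adjoint ip S T"
  using assms unfolding is_adjoint_def by (metis ip_star)

lemma adjointable_plus:
  assumes "adjointable ip S" "adjointable ip T"
  shows "adjointable ip (\<lambda>x. S x + T x)"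
proof -
  obtain S' T' where "is_adjoint ip S S'" "is_adjoint ip T T'"
    using assms unfolding adjointable_def by blast
  then have "is_adjoint ip (\<lambda>x. S x + T x) (\<lambda>x. S' x + T' x)"
    by (simp add: is_adjoint_def ip_add_left ip_add_right)
  then show ?thesis unfolding adjointable_def by blast
qed

lemma adjointable_minus:
  assumes "adjointable ip S" "adjointable ip T"
  shows "adjointable ip (\<lambda>x. S x - T x)"
proof -
  obtain S' T' where "is_adjoint ip S S'" "is_adjoint ip T T'"
    using assms unfolding adjointable_def by blast
  then have "is_adjoint ip (\<lambda>x. S x - T x) (\<lambda>x. S' x - T' x)"
    by (simp add: is_adjoint_def ip_diff_left ip_diff_right)
  then show ?thesis unfolding adjointable_def by blast
qed

lemma adjointable_ident: "adjointable ip (\<lambda>x. x)"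
  unfolding adjointable_def is_adjoint_def by (rule exI[of _ "\<lambda>x. x"]) simp

text \<open>The adjoint carries \<open>T\<close> into the second slot of \<open>ip\<close>, where
  additivity is read off and nondegeneracy applies.\<close>

lemma adjointable_additive:
  assumes "adjointable ip T"
  shows "additive T"
proof
  fix x y
  obtain S where "is_adjoint ip S T"
    using assms is_adjoint_sym unfolding adjointable_def by blast
  then have S: "ip z (T v) = ip (S z) v" for z v
    by (simp add: is_adjoint_def)
  show "T (x + y) = T x + T y"
    by (rule ip_right_eqI) (simp add: S ip_add_right)
qed

text \<open>Definiteness is used twice: with \<open>y = S (C x)\<close>, first
  \<open>ip y y = ip (C y) (C x) = 0\<close> kills \<open>y\<close>, then
  \<open>ip (C x) (C x) = ip x y = 0\<close> kills \<open>C x\<close>.\<close>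

lemma eq_zero_if_sandwich_adjoint_zero:
  assumes C: "is_adjoint ip C S" and "\<And>x. C (S (C x)) = 0"
  shows "C x = 0"
proof -
  have "ip (S (C x)) (S (C x)) = 0"
    using C assms(2) by (metis is_adjoint_def ip_zero_left)
  then have "S (C x) = 0" by (rule ip_definite)
  then have "ip (C x) (C x) = 0"
    using C by (simp add: is_adjoint_def)
  then show ?thesis by (rule ip_definite)
qed

lemma eq_zero_if_sandwich_zero:
  assumes "adjointable ip C" and "\<And>W x. adjointable ip W \<Longrightarrow> C (W (C x)) = 0"
  shows "C x = 0"
proof -
  obtain S where S: "is_adjoint ip C S"
    using assms(1) unfolding adjointable_def by blast
  then have "adjointable ip S"
    using is_adjoint_sym unfolding adjointable_def by blast
  with S show ?thesis
    using assms(2) eq_zero_if_sandwich_adjoint_zero by blast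
qed

text \<open>The algebraic core, with an arbitrary {1}-inverse \<open>X\<close> as reference; the
  Moore-Penrose inverse is one such \<open>X\<close>.\<close>

lemma one_inverse_independent_iff:
  assumes A: "adjointable ip A" and B: "adjointable ip B"
    and X: "is_one_inverse ip (A +\<^sub>o B) X"
  shows "(\<forall>G G'. is_one_inverse ip (A +\<^sub>o B) G \<longrightarrow> is_one_inverse ip (A +\<^sub>o B) G' \<longrightarrow>
            A \<circ> G \<circ> B = A \<circ> G' \<circ> B) \<longleftrightarrow>
         A = A \<circ> X \<circ> (A +\<^sub>o B) \<and> B = (A +\<^sub>o B) \<circ> X \<circ> B"
    (is "?indep \<longleftrightarrow> ?ranges")
proof
  define T where "T = A +\<^sub>o B"
  have T_apply: "T x = A x + B x" for x
    by (simp add: T_def op_add_def)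
  have T: "adjointable ip T"
    using adjointable_plus[OF A B] by (simp add: T_def op_add_def)
  have X': "adjointable ip X" and TXT: "T (X (T x)) = T x" for x
    using X by (auto simp: is_one_inverse_def T_def fun_eq_iff)
  note add_A = adjointable_additive[OF A] and add_T = adjointable_additive[OF T]
    and add_X = adjointable_additive[OF X']
  {
    assume ?ranges
    then have AXT: "A (X (T x)) = A x" and TXB: "T (X (B x)) = B x" for x
      by (auto simp: T_def fun_eq_iff)
    have "A (G (B x)) = A (X (B x))" if "is_one_inverse ip T G" for G x
    proof -
      have "T (G (T y)) = T y" for y
        using that by (auto simp: is_one_inverse_def fun_eq_iff)
      then show ?thesis by (metis AXT TXB)
    qed
    then show ?indep
      by (auto simp: T_def fun_eq_iff)
  next
    assume indep: ?indep
    define N where "N = (\<lambda>x. x - X (T x))"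
    define M where "M = (\<lambda>x. x - T (X x))"
    have N: "adjointable ip N" and M: "adjointable ip M"
      using adjointable_minus[OF adjointable_ident adjointable_comp[OF X' T]]
        adjointable_minus[OF adjointable_ident adjointable_comp[OF T X']]
      by (simp_all add: N_def M_def)
    have TN: "T (N x) = 0" and MT: "M (T x) = 0" for x
      by (simp_all add: N_def M_def additive.diff[OF add_T] TXT)
    have BN: "B (N x) = - A (N x)" for x
      using TN[of x] by (simp add: T_apply eq_neg_iff_add_eq_0 add.commute)
    have MA: "M (A x) = - M (B x)" for x
      using MT[of x]
      by (simp add: T_apply additive.add[OF adjointable_additive[OF M]] eq_neg_iff_add_eq_0)
    \<comment> \<open>Perturbing \<open>X\<close> by \<open>V\<close> with \<open>T V T = 0\<close>
      yields another {1}-inverse, and comparing the two isolates \<open>A V B\<close>. Both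
      \<open>N W\<close> and \<open>W M\<close> are such \<open>V\<close>.\<close>
    have vanish: "A (V (B x)) = 0" if V: "adjointable ip V" and TVT: "\<And>y. T (V (T y)) = 0" for V x
    proof -
      have "is_one_inverse ip T (\<lambda>y. X y + V y)"
        using adjointable_plus[OF X' V] TVT
        by (simp add: is_one_inverse_def fun_eq_iff additive.add[OF add_T] TXT)
      with indep X have "A \<circ> (\<lambda>y. X y + V y) \<circ> B = A \<circ> X \<circ> B"
        unfolding T_def by blast
      then have "A (X (B x) + V (B x)) = A (X (B x))"
        by (simp add: fun_eq_iff)
      then show ?thesis by (simp add: additive.add[OF add_A])
    qed
    have "(A \<circ> N) x = 0" for x
    proof (rule eq_zero_if_sandwich_zero[OF adjointable_comp[OF A N]])
      fix W x assume W: "adjointable ip W"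
      \<comment> \<open>Evaluated at \<open>N x\<close>, the inner \<open>B\<close> becomes
        \<open>- A\<close>, and the sign passes out through \<open>W\<close>, \<open>N\<close> and
        \<open>A\<close>.\<close>
      have "A ((N \<circ> W) (B (N x))) = 0"
        by (rule vanish[OF adjointable_comp[OF N W]]) (simp add: TN)
      then show "(A \<circ> N) (W ((A \<circ> N) x)) = 0"
        by (simp add: BN additive.minus[OF adjointable_additive[OF W]]
            additive.minus[OF adjointable_additive[OF N]] additive.minus[OF add_A])
    qed
    moreover have "(M \<circ> B) x = 0" for x
    proof (rule eq_zero_if_sandwich_zero[OF adjointable_comp[OF M B]])
      fix W x assume W: "adjointable ip W"
      have "A ((W \<circ> M) (B x)) = 0"
        by (rule vanish[OF adjointable_comp[OF W M]])
          (simp add: MT additive.zero[OF adjointable_additive[OF W]] additive.zero[OF add_T])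
      \<comment> \<open>Applying \<open>M\<close> on the left turns the outer \<open>A\<close> into
        \<open>- B\<close>.\<close>
      then show "(M \<circ> B) (W ((M \<circ> B) x)) = 0"
        using MA[of "W (M (B x))"] additive.zero[OF adjointable_additive[OF M]] by simp
    qed
    \<comment> \<open>Unfolded, \<open>A N = 0\<close> reads \<open>A = A X T\<close>, and
      \<open>M B = 0\<close> reads \<open>B = T X B\<close>.\<close>
    ultimately show ?ranges
      by (simp add: N_def M_def additive.diff[OF add_A] fun_eq_iff T_def[symmetric])
  }
qed

end

theorem theorem3p3:
  fixes act :: "'h::{complex_vector, banach} \<Rightarrow> 'a::cstar_algebra \<Rightarrow> 'h"
    and ip :: "'h \<Rightarrow> 'h \<Rightarrow> 'a"
    and A B :: "'h \<Rightarrow> 'h"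
  assumes "hilbert_cstar_module act ip"
    and "adjointable ip A" and "adjointable ip B"
    and "mp_invertible ip (A +\<^sub>o B)"
  shows "parallel_summable ip A B \<longleftrightarrow>
    A = A \<circ> mp_inverse ip (A +\<^sub>o B) \<circ> (A +\<^sub>o B) \<and>
    B = (A +\<^sub>o B) \<circ> mp_inverse ip (A +\<^sub>o B) \<circ> B"
proof -
  interpret hilbert_cstar_module act ip by fact
  obtain X where "adjointable ip (A +\<^sub>o B)" and X: "is_mp_inverse ip (A +\<^sub>o B) X"
    using assms(4) unfolding mp_invertible_def by blast
  then have "mp_inverse ip (A +\<^sub>o B) = X"
    by (rule mp_inverse_eqI)
  moreover have "is_one_inverse ip (A +\<^sub>o B) X"
    using X by (simp add: is_mp_inverse_def is_one_inverse_def)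
  ultimately show ?thesis
    using one_inverse_independent_iff[OF assms(2,3)] assms(2-4)
    by (simp add: parallel_summable_def)
qed

end
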